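(* Let $C_{1,2,l}(N)$ ($1\le l\le \lfloor N/2\rfloor$) denote the coefficient of $(x+1)^{-l}$ in the partial fraction decomposition over $\mathbb{C}$ of $\prod_{j=1}^N\frac{1}{1-x^j}$. Then: (i) for all integers $n\ge 1$, $C_{1,2,n}(2n+1)=\dfrac{1}{2^{2n+1}\,n!}$; (ii) for all integers $n\ge 2$, $C_{1,2,n-1}(2n+1)=\dfrac{2n^2+2n+1}{2^{2n+2}\,n!}$; (iii) for all integers $n\ge 3$, $C_{1,2,n-2}(2n+1)=\dfrac{18n^5+46n^4+61n^3+53n^2+29n+9}{9\cdot 2^{2n+3}\,(n+1)!}$.
   Context: For each integer $N\ge 1$, the Rademacher coefficients $C_{h,k,l}(N)\in\mathbb{C}$ are the unique numbers satisfying $$\prod_{j=1}^N \frac{1}{1-x^j}=\sum_{k=1}^N\ \sum_{\substack{0\le h<k\\ \gcd(h,k)=1}}\ \sum_{l=1}^{\lfloor N/k\rfloor}\frac{C_{h,k,l}(N)}{(x-e^{2\pi i h/k})^l}.$$ For $k=2$ the only admissible $h$ is $h=1$, the corresponding root of unity is $-1$, and $C_{1,2,l}(N)$ is the coefficient of $(x+1)^{-l}$. *)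

theory Defs
  imports "HOL-Analysis.Analysis"
begin

definition rademacher_index :: "nat \<Rightarrow> nat \<Rightarrow> nat \<Rightarrow> nat \<Rightarrow> bool" where
  "rademacher_index N h k l \<longleftrightarrow>
     k \<in> {1..N} \<and> h < k \<and> coprime h k \<and> l \<in> {1..N div k}"

(* The identity of rational functions is required at every complex number that is not
   a pole, i.e. not a root of unity of order at most N (in HOL, division by zero is zero,
   so the poles have to be left out).  The family is extended by zero outside the index
   range, so that it is unique as a function. *)
definition rademacher_expansion :: "nat \<Rightarrow> (nat \<Rightarrow> nat \<Rightarrow> nat \<Rightarrow> complex) \<Rightarrow> bool" where
  "rademacher_expansion N C \<longleftrightarrow>
     (\<forall>h k l. \<not> rademacher_index N h k l \<longrightarrow> C h k l = 0) \<and>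
     (\<forall>x::complex. (\<forall>j\<in>{1..N}. x ^ j \<noteq> 1) \<longrightarrow>
        (\<Prod>j=1..N. 1 / (1 - x ^ j)) =
        (\<Sum>k=1..N. \<Sum>h | h < k \<and> coprime h k. \<Sum>l=1..N div k.
           C h k l / (x - exp (2 * of_real pi * \<i> * of_nat h / of_nat k)) ^ l))"

definition rademacher_coeff :: "nat \<Rightarrow> nat \<Rightarrow> nat \<Rightarrow> nat \<Rightarrow> complex" where
  "rademacher_coeff h k l N = (THE C. rademacher_expansion N C) h k l"

end

theory Submission
  imports
    Defs
    "HOL-Complex_Analysis.Laurent_Convergence"
    "HOL-Computational_Algebra.Fundamental_Theorem_Algebra"
begin

text \<open>
  Put \<open>x = y - 1\<close>.  Among the factors \<open>1 - x ^ j\<close> with \<open>j \<le> 2 * n + 1\<close>, exactly the \<open>n\<close> factors with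
  even \<open>j\<close> vanish at \<open>y = 0\<close>, each of them simply.  Hence the product of all factors is \<open>y ^ n\<close> times a
  polynomial \<open>P n\<close> in \<open>y\<close> with nonzero constant term (the series \<open>cofactor n\<close>), and the
  coefficient of \<open>(x + 1) ^ (-(n - i))\<close> in the partial fraction decomposition is the \<open>i\<close>-th Taylor coefficient of \<open>1 / P n\<close>, for \<open>i < n\<close>
  (\<open>rademacher_coeff_eq_inverse_cofactor\<close>).

  For \<open>i = 0, 1, 2\<close> these Taylor coefficients come from a recursion.  The quotient
  \<open>P (n + 1) / P n\<close> is the product of the factor with \<open>j = 2 * n + 2\<close>, divided by \<open>y\<close>, and the factor
  with \<open>j = 2 * n + 3\<close>; its coefficients up to \<open>y ^ 2\<close> come from binomial coefficients, and the stated
  closed forms satisfy the resulting linear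
  recursion (\<open>inverse_cofactor_nth\<close>).

  The coefficients are defined by a definite description, so it also has to be shown that the
  decomposition exists and is unique.  Existence is the elementary partial fraction argument
  (\<open>partial_fractions_exist\<close>) applied to the factorization of the product over roots of unity
  (\<open>prod_one_minus_power_factorization\<close>).  Uniqueness holds because, at each pole, the coefficients
  are Taylor coefficients of a function that depends only on the product
  (\<open>rademacher_expansion_fps\<close>).
\<close>

section \<open>Partial fractions\<close>

text \<open>
  Induction on the number of linear factors.  As long as two distinct points
  \<open>a\<close>, \<open>b\<close> occur, dividing \<open>(x - b) - (x - a) = a - b\<close> by the whole product writes the
  reciprocal as a combination of two reciprocals with one factor fewer; a single remaining point is
  a pure power, which is its own expansion.  The exponents must not all vanish, because the
  constant \<open>1\<close> is not a sum of polar terms.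
\<close>

lemma partial_fractions_exist:
  fixes r :: "'i \<Rightarrow> complex"
  assumes "finite I" "inj_on r I" "sum m I > 0"
  shows "\<exists>c. \<forall>x. x \<notin> r ` I \<longrightarrow>
           1 / (\<Prod>i\<in>I. (x - r i) ^ m i) = (\<Sum>i\<in>I. \<Sum>l=1..m i. c i l / (x - r i) ^ l)"
  using assms(3)
proof (induction "sum m I" arbitrary: m rule: less_induct)
  case less
  show ?case
  proof (cases "\<exists>a\<in>I. \<exists>b\<in>I. a \<noteq> b \<and> m a > 0 \<and> m b > 0")
    case True
    then obtain a b where ab: "a \<in> I" "b \<in> I" "a \<noteq> b" "m a > 0" "m b > 0" by blast
    have rab: "r a \<noteq> r b" using ab assms(2) by (auto dest: inj_onD)
    \<comment> \<open>Cancelling a factor at \<open>u\<close> leaves a reciprocal to which the induction hypothesis applies; the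
        point \<open>v\<close> keeps the total exponent positive.\<close>
    have drop: "\<exists>c. \<forall>x. x \<notin> r ` I \<longrightarrow>
        (x - r u) / (\<Prod>i\<in>I. (x - r i) ^ m i) = (\<Sum>i\<in>I. \<Sum>l=1..m i. c i l / (x - r i) ^ l)"
      if uv: "u \<in> I" "v \<in> I" "u \<noteq> v" "m u > 0" "m v > 0" for u v
    proof -
      define m' where "m' = m(u := m u - 1)"
      have "sum m I = m u + sum m (I - {u})" "sum m' I = m' u + sum m' (I - {u})"
        using assms(1) uv by (auto intro: sum.remove)
      moreover have "sum m' (I - {u}) = sum m (I - {u})" by (auto simp: m'_def intro: sum.cong)
      ultimately have lt: "sum m' I < sum m I" using uv by (simp add: m'_def)
      have "m' v > 0" using uv by (simp add: m'_def)
      hence pos: "sum m' I > 0" using assms(1) uv(2) by (metis sum_eq_0_iff gr0I not_less0)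
      obtain c where c: "\<And>x. x \<notin> r ` I \<Longrightarrow>
          1 / (\<Prod>i\<in>I. (x - r i) ^ m' i) = (\<Sum>i\<in>I. \<Sum>l=1..m' i. c i l / (x - r i) ^ l)"
        using less(1)[OF lt pos] by blast
      show ?thesis
      proof (intro exI[of _ "\<lambda>i l. if l \<le> m' i then c i l else 0"] allI impI)
        fix x assume x: "x \<notin> r ` I"
        have "(\<Prod>i\<in>I. (x - r i) ^ m i) = (x - r u) ^ m u * (\<Prod>i\<in>I - {u}. (x - r i) ^ m i)"
          using assms(1) uv by (intro prod.remove) auto
        also have "\<dots> = (x - r u) * ((x - r u) ^ m' u * (\<Prod>i\<in>I - {u}. (x - r i) ^ m' i))"
          using uv(4) by (simp add: m'_def power_eq_if)
        also have "(x - r u) ^ m' u * (\<Prod>i\<in>I - {u}. (x - r i) ^ m' i) = (\<Prod>i\<in>I. (x - r i) ^ m' i)"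
          using assms(1) uv by (intro prod.remove[symmetric]) auto
        finally have "(x - r u) / (\<Prod>i\<in>I. (x - r i) ^ m i) = 1 / (\<Prod>i\<in>I. (x - r i) ^ m' i)"
          using x uv(1) by auto
        also have "\<dots> = (\<Sum>i\<in>I. \<Sum>l=1..m' i. c i l / (x - r i) ^ l)" by (rule c[OF x])
        also have "\<dots> = (\<Sum>i\<in>I. \<Sum>l=1..m i. (if l \<le> m' i then c i l else 0) / (x - r i) ^ l)"
          by (intro sum.cong refl sum.mono_neutral_cong_left) (auto simp: m'_def split: if_splits)
        finally show "(x - r u) / (\<Prod>i\<in>I. (x - r i) ^ m i) = \<dots>" .
      qed
    qed
    obtain c where c: "\<And>x. x \<notin> r ` I \<Longrightarrow>
        (x - r a) / (\<Prod>i\<in>I. (x - r i) ^ m i) = (\<Sum>i\<in>I. \<Sum>l=1..m i. c i l / (x - r i) ^ l)"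
      using drop[of a b] ab by blast
    obtain d where d: "\<And>x. x \<notin> r ` I \<Longrightarrow>
        (x - r b) / (\<Prod>i\<in>I. (x - r i) ^ m i) = (\<Sum>i\<in>I. \<Sum>l=1..m i. d i l / (x - r i) ^ l)"
      using drop[of b a] ab by blast
    show ?thesis
    proof (intro exI[of _ "\<lambda>i l. (d i l - c i l) / (r a - r b)"] allI impI)
      fix x assume x: "x \<notin> r ` I"
      let ?Q = "\<Prod>i\<in>I. (x - r i) ^ m i"
      have "1 / ?Q = ((x - r b) / ?Q - (x - r a) / ?Q) / (r a - r b)"
        using rab by (simp add: diff_divide_distrib[symmetric])
      also have "\<dots> = (\<Sum>i\<in>I. \<Sum>l=1..m i. (d i l - c i l) / (r a - r b) / (x - r i) ^ l)"
        unfolding c[OF x] d[OF x]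
        by (simp add: sum_subtractf[symmetric] sum_divide_distrib diff_divide_distrib mult.commute)
      finally show "1 / ?Q = \<dots>" .
    qed
  next
    case False
    from less.prems obtain a where a: "a \<in> I" "m a > 0"
      by (metis sum.neutral gr0I not_less0)
    have 0: "m i = 0" if "i \<in> I - {a}" for i using False a that by (metis DiffE singletonI gr0I)
    show ?thesis
    proof (intro exI[of _ "\<lambda>i l. if i = a \<and> l = m a then 1 else 0"] allI impI)
      fix x
      have "(\<Prod>i\<in>I. (x - r i) ^ m i) = (x - r a) ^ m a"
        using 0 a assms(1) by (subst prod.remove[of _ a]) auto
      moreover have "(\<Sum>i\<in>I. \<Sum>l=1..m i. (if i = a \<and> l = m a then 1 else 0) / (x - r i) ^ l)
           = (\<Sum>l=1..m a. (if l = m a then 1 else 0) / (x - r a) ^ l)"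
        using 0 a assms(1) by (subst sum.remove[of _ a]) auto
      moreover have "\<dots> = (\<Sum>l=1..m a. if l = m a then 1 / (x - r a) ^ l else 0)"
        by (intro sum.cong) auto
      ultimately show "1 / (\<Prod>i\<in>I. (x - r i) ^ m i) =
          (\<Sum>i\<in>I. \<Sum>l=1..m i. (if i = a \<and> l = m a then 1 else 0) / (x - r i) ^ l)"
        using a by simp
    qed
  qed
qed

text \<open>
  Multiplying a sum of polar terms by \<open>y\<close> to the pole order at one of the points makes the function
  analytic there, and the remaining points only contribute from that power on, so that the
  coefficients at this pole become the low Taylor coefficients.  The extra factor \<open>y\<close> makes the
  function vanish at \<open>y = 0\<close>, which is also the value that division by zero produces there: identities
  that hold near the pole then hold at the pole itself, without a continuity argument.
\<close>

lemma pole_has_fps_expansion: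
  fixes r :: "'i \<Rightarrow> complex"
  assumes I: "finite I" "inj_on r I" "a \<in> I"
  obtains G where
    "(\<lambda>y. y ^ Suc (m a) * (\<Sum>i\<in>I. \<Sum>l=1..m i. c i l / (r a + y - r i) ^ l)) has_fps_expansion G"
    "\<And>l. l \<in> {1..m a} \<Longrightarrow> fps_nth G (Suc (m a) - l) = c a l"
proof -
  define A :: "complex fps" where
    "A = (\<Sum>l=1..m a. fps_const (c a l) * fps_X ^ (Suc (m a) - l))"
  define B :: "complex fps" where
    "B = (\<Sum>i\<in>I - {a}. \<Sum>l=1..m i. fps_const (c i l) * inverse (fps_const (r a - r i) + fps_X) ^ l)"
  have "(\<lambda>y. (\<Sum>l=1..m a. c a l * y ^ (Suc (m a) - l)) + y ^ Suc (m a) *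
      (\<Sum>i\<in>I - {a}. \<Sum>l=1..m i. c i l * inverse ((r a - r i) + y) ^ l))
      has_fps_expansion A + fps_X ^ Suc (m a) * B"
    unfolding A_def B_def using I
    by (intro fps_expansion_intros) (auto dest: inj_onD)
  also have "(\<lambda>y. (\<Sum>l=1..m a. c a l * y ^ (Suc (m a) - l)) + y ^ Suc (m a) *
      (\<Sum>i\<in>I - {a}. \<Sum>l=1..m i. c i l * inverse ((r a - r i) + y) ^ l)) =
     (\<lambda>y. y ^ Suc (m a) * (\<Sum>i\<in>I. \<Sum>l=1..m i. c i l / (r a + y - r i) ^ l))"
  proof
    fix y
    have "y ^ Suc (m a) * (c a l / y ^ l) = c a l * y ^ (Suc (m a) - l)" if "l \<in> {1..m a}" for l
      using that by (cases "y = 0") (auto simp: power_diff)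
    hence "(\<Sum>l=1..m a. c a l * y ^ (Suc (m a) - l)) = y ^ Suc (m a) * (\<Sum>l=1..m a. c a l / y ^ l)"
      unfolding sum_distrib_left by (intro sum.cong refl) simp
    moreover have "(\<Sum>i\<in>I. \<Sum>l=1..m i. c i l / (r a + y - r i) ^ l) = (\<Sum>l=1..m a. c a l / y ^ l) +
        (\<Sum>i\<in>I - {a}. \<Sum>l=1..m i. c i l * inverse ((r a - r i) + y) ^ l)"
      using I by (subst sum.remove[of I a]) (simp_all add: divide_inverse power_inverse algebra_simps)
    ultimately show "(\<Sum>l=1..m a. c a l * y ^ (Suc (m a) - l)) + y ^ Suc (m a) *
      (\<Sum>i\<in>I - {a}. \<Sum>l=1..m i. c i l * inverse ((r a - r i) + y) ^ l) =
      y ^ Suc (m a) * (\<Sum>i\<in>I. \<Sum>l=1..m i. c i l / (r a + y - r i) ^ l)"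
      by (simp only: distrib_left)
  qed
  finally show ?thesis
  proof (rule that)
    fix l assume l: "l \<in> {1..m a}"
    have eq: "Suc (m a) - l = Suc (m a) - l' \<longleftrightarrow> l' = l" if "l' \<in> {1..m a}" for l'
      using that l by auto
    have "fps_nth A (Suc (m a) - l) = (\<Sum>l'=1..m a. if l' = l then c a l else 0)"
      unfolding A_def fps_sum_nth using eq by (intro sum.cong refl) (auto simp: fps_X_power_nth)
    also have "\<dots> = c a l" using l by simp
    moreover have "fps_nth (fps_X ^ Suc (m a) * B) (Suc (m a) - l) = 0"
      using l by (simp add: fps_X_power_mult_nth del: power_Suc)
    ultimately show "fps_nth (A + fps_X ^ Suc (m a) * B) (Suc (m a) - l) = c a l" by simp
  qed
qed

lemma eventually_not_other_pole:
  fixes r :: "'i \<Rightarrow> complex"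
  assumes "finite I"
  shows "\<forall>\<^sub>F y in nhds 0. y = 0 \<or> r a + y \<notin> r ` I"
proof -
  have "((\<lambda>y. r a + y) \<longlongrightarrow> r a + 0) (nhds 0)"
    by (intro tendsto_intros filterlim_ident)
  moreover have "open (- (r ` I - {r a}))"
    using assms by (intro open_Compl finite_imp_closed) auto
  ultimately have "\<forall>\<^sub>F y in nhds 0. r a + y \<in> - (r ` I - {r a})"
    by (intro topological_tendstoD) auto
  thus ?thesis by eventually_elim auto
qed

section \<open>Factorization over the roots of unity\<close>

text \<open>
  The reduced fractions \<open>h / k\<close> in \<open>[0, 1)\<close> of denominator at most \<open>N\<close>, as pairs \<open>(k, h)\<close> with the
  denominator first; they index the primitive \<open>k\<close>-th roots of unity for \<open>k \<le> N\<close>.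
\<close>

definition farey :: "nat \<Rightarrow> (nat \<times> nat) set" where
  "farey N = (SIGMA k:{1..N}. {h. h < k \<and> coprime h k})"

definition farey_root :: "nat \<times> nat \<Rightarrow> complex" where
  "farey_root p = exp (2 * of_real pi * \<i> * of_nat (snd p) / of_nat (fst p))"

lemma finite_farey [simp]: "finite (farey N)"
  by (auto simp: farey_def)

lemma farey_root_power_eq_1_iff:
  assumes "p \<in> farey N"
  shows "farey_root p ^ j = 1 \<longleftrightarrow> fst p dvd j"
proof -
  obtain k h where p: "p = (k, h)" by (cases p)
  with assms have k: "1 \<le> k" and hk: "coprime h k" by (auto simp: farey_def)
  have "farey_root p ^ j = exp (2 * of_real pi * \<i> * of_nat (h * j) / of_nat k)"
    unfolding p farey_root_def exp_of_nat_mult[symmetric] by (simp add: algebra_simps)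
  hence "farey_root p ^ j = 1 \<longleftrightarrow> k dvd h * j"
    using complex_root_unity_eq_1[OF k, of "h * j"] by simp
  also have "\<dots> \<longleftrightarrow> k dvd j"
    using hk by (simp add: coprime_commute coprime_dvd_mult_right_iff)
  finally show ?thesis by (simp add: p)
qed

lemma inj_on_farey_root: "inj_on farey_root (farey N)"
proof (rule inj_onI)
  fix p q assume pq: "p \<in> farey N" "q \<in> farey N" "farey_root p = farey_root q"
  have "fst p dvd j \<longleftrightarrow> fst q dvd j" for j
    using pq farey_root_power_eq_1_iff[of _ N j] by metis
  hence k: "fst p = fst q" by (meson dvd_antisym dvd_refl)
  have "1 \<le> fst p" using pq by (auto simp: farey_def)
  from complex_root_unity_eq[OF this, of "snd p" "snd q"] pq(3) k
  have "snd p mod fst p = snd q mod fst p" by (simp add: farey_root_def cong_def)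
  with pq k have "snd p = snd q" by (auto simp: farey_def)
  with k show "p = q" by (simp add: prod_eq_iff)
qed

lemma bij_betw_farey_root:
  assumes "j \<in> {1..N}"
  shows "bij_betw farey_root {p \<in> farey N. fst p dvd j} {z. z ^ j = 1}"
  unfolding bij_betw_def
proof
  show "inj_on farey_root {p \<in> farey N. fst p dvd j}"
    using inj_on_farey_root by (rule inj_on_subset) auto
  show "farey_root ` {p \<in> farey N. fst p dvd j} = {z. z ^ j = 1}"
  proof
    show "farey_root ` {p \<in> farey N. fst p dvd j} \<subseteq> {z. z ^ j = 1}"
      using farey_root_power_eq_1_iff by auto
    show "{z. z ^ j = 1} \<subseteq> farey_root ` {p \<in> farey N. fst p dvd j}"
    proof
      fix z :: complex assume "z \<in> {z. z ^ j = 1}"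
      then obtain a where a: "a < j" "z = exp (2 * of_real pi * \<i> * of_nat a / of_nat j)"
        using complex_roots_unity[of j] assms by auto
      define g where "g = gcd a j"
      have g: "g > 0" using assms by (simp add: g_def)
      have eqs: "a = g * (a div g)" "j = g * (j div g)" by (simp_all add: g_def)
      have "coprime (a div g) (j div g)"
        unfolding g_def using assms by (intro div_gcd_coprime) auto
      moreover have "a div g < j div g"
        using a(1) eqs g by (metis nat_mult_less_cancel1)
      moreover have "j div g \<in> {1..N}"
        using assms g eqs(2) div_le_dividend[of j g]
        by (metis One_nat_def Suc_leI atLeastAtMost_iff le_trans mult_is_0 neq0_conv not_one_le_zero)
      ultimately have "(j div g, a div g) \<in> farey N" by (simp add: farey_def)
      moreover have "j div g dvd j" using eqs(2) by (metis dvd_triv_right)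
      moreover have "farey_root (j div g, a div g) = z"
      proof -
        have "of_nat a / of_nat j = (of_nat (a div g) / of_nat (j div g) :: complex)"
          using g eqs by (metis mult_divide_mult_cancel_left of_nat_eq_0_iff of_nat_mult not_gr0)
        thus ?thesis unfolding a farey_root_def fst_conv snd_conv times_divide_eq_right[symmetric] by simp
      qed
      ultimately show "z \<in> farey_root ` {p \<in> farey N. fst p dvd j}"
        by (intro image_eqI[of _ _ "(j div g, a div g)"]) auto
    qed
  qed
qed

text \<open>The polynomial and its derivative \<open>j * z ^ (j - 1)\<close> have no common root, so every root is simple.\<close>

lemma power_minus_1_eq_prod_roots:
  assumes "j \<ge> 1"
  shows "(x::complex) ^ j - 1 = (\<Prod>z | z ^ j = 1. x - z)"
proof -
  define p :: "complex poly" where "p = monom 1 j - 1"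
  have [simp]: "poly p z = z ^ j - 1" for z by (simp add: p_def poly_monom)
  have "poly (pderiv p) z = of_nat j * z ^ (j - 1)" for z
    by (simp add: p_def pderiv_diff pderiv_monom poly_monom)
  hence sf: "rsquarefree p"
    unfolding rsquarefree_roots using assms by (auto simp: power_0_left)
  have "coeff p j = 1" "degree p = j"
    using assms by (auto simp: p_def coeff_1 intro!: antisym degree_diff_le le_degree
        simp: degree_monom_eq)
  hence "(\<Prod>z | poly p z = 0. [:- z, 1:]) = p"
    using complex_poly_decompose_rsquarefree[OF sf] by simp
  hence "poly p x = poly (\<Prod>z | poly p z = 0. [:- z, 1:]) x" by simp
  thus ?thesis by (simp add: poly_prod)
qed

lemma card_multiples:
  assumes "k \<ge> 1"
  shows "card {j \<in> {1..N}. k dvd j} = N div (k::nat)"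
proof -
  have "{j \<in> {1..N}. k dvd j} = (*) k ` {1..N div k}"
  proof (intro equalityI subsetI)
    fix j assume "j \<in> {j \<in> {1..N}. k dvd j}"
    then obtain i where "j = k * i" "1 \<le> k * i" "k * i \<le> N" by auto
    thus "j \<in> (*) k ` {1..N div k}"
      using assms by (auto simp: less_eq_div_iff_mult_less_eq mult.commute Suc_le_eq)
  next
    fix j assume "j \<in> (*) k ` {1..N div k}"
    thus "j \<in> {j \<in> {1..N}. k dvd j}"
      using assms by (auto simp: less_eq_div_iff_mult_less_eq mult.commute Suc_le_eq)
  qed
  moreover have "inj_on ((*) k) {1..N div k}" using assms by (auto simp: inj_on_def)
  ultimately show ?thesis by (simp add: card_image)
qed

text \<open>
  A primitive \<open>k\<close>-th root of unity is a root of \<open>1 - x ^ j\<close> exactly when \<open>k\<close> divides \<open>j\<close>, so its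
  multiplicity in the product is the number of multiples of \<open>k\<close> up to \<open>N\<close>.
\<close>

lemma prod_one_minus_power_factorization:
  "(\<Prod>j=1..N. 1 - x ^ j) = (-1) ^ N * (\<Prod>p\<in>farey N. (x - farey_root p) ^ (N div fst p))"
proof -
  have "(\<Prod>j=1..N. 1 - x ^ j) = (\<Prod>j=1..N. (-1) * (x ^ j - 1))" by simp
  also have "\<dots> = (-1) ^ N * (\<Prod>j=1..N. x ^ j - 1)"
    unfolding prod.distrib by simp
  also have "(\<Prod>j=1..N. x ^ j - 1) = (\<Prod>j=1..N. \<Prod>p | p \<in> farey N \<and> fst p dvd j. x - farey_root p)"
  proof (intro prod.cong refl)
    fix j assume j: "j \<in> {1..N}"
    hence "x ^ j - 1 = (\<Prod>z | z ^ j = 1. x - z)" by (intro power_minus_1_eq_prod_roots) auto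
    also have "\<dots> = (\<Prod>p | p \<in> farey N \<and> fst p dvd j. x - farey_root p)"
      using prod.reindex_bij_betw[OF bij_betw_farey_root[OF j], of "\<lambda>z. x - z"] by simp
    finally show "x ^ j - 1 = \<dots>" .
  qed
  also have "\<dots> = (\<Prod>p\<in>farey N. \<Prod>j | j \<in> {1..N} \<and> fst p dvd j. x - farey_root p)"
    by (rule prod.swap_restrict) auto
  also have "\<dots> = (\<Prod>p\<in>farey N. (x - farey_root p) ^ (N div fst p))"
    by (intro prod.cong refl) (auto simp: card_multiples[simplified] farey_def)
  finally show ?thesis .
qed

section \<open>Existence and uniqueness of the Rademacher coefficients\<close>

lemma rademacher_expansion_iff:
  "rademacher_expansion N C \<longleftrightarrow>
     (\<forall>h k l. \<not> rademacher_index N h k l \<longrightarrow> C h k l = 0) \<and>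
     (\<forall>x. x \<notin> farey_root ` farey N \<longrightarrow>
        1 / (\<Prod>j=1..N. 1 - x ^ j) =
        (\<Sum>p\<in>farey N. \<Sum>l=1..N div fst p. C (snd p) (fst p) l / (x - farey_root p) ^ l))"
proof -
  have poles: "(\<forall>j\<in>{1..N}. x ^ j \<noteq> 1) \<longleftrightarrow> x \<notin> farey_root ` farey N" for x :: complex
  proof -
    have "x ^ j \<noteq> 1" if "x \<notin> farey_root ` farey N" "j \<in> {1..N}" for j
      using bij_betw_imp_surj_on[OF bij_betw_farey_root[OF that(2)]] that(1) by auto
    moreover have "\<exists>j\<in>{1..N}. x ^ j = 1" if "p \<in> farey N" "x = farey_root p" for p
      using farey_root_power_eq_1_iff[OF that(1), of "fst p"] that
      by (intro bexI[of _ "fst p"]) (auto simp: farey_def)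
    ultimately show ?thesis by blast
  qed
  have sum: "(\<Sum>k=1..N. \<Sum>h | h < k \<and> coprime h k. \<Sum>l=1..N div k.
           C h k l / (x - exp (2 * of_real pi * \<i> * of_nat h / of_nat k)) ^ l) =
        (\<Sum>p\<in>farey N. \<Sum>l=1..N div fst p. C (snd p) (fst p) l / (x - farey_root p) ^ l)" for x
    unfolding farey_def farey_root_def
    by (subst sum.Sigma) (auto simp: case_prod_unfold)
  have prod: "(\<Prod>j=1..N. 1 / (1 - x ^ j)) = 1 / (\<Prod>j=1..N. 1 - x ^ j)" for x :: complex
    by (simp add: prod_dividef)
  show ?thesis unfolding rademacher_expansion_def poles sum prod ..
qed

lemma rademacher_expansion_exists:
  assumes "N \<ge> 1"
  shows "\<exists>C. rademacher_expansion N C"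
proof -
  have "(1, 0) \<in> farey N" using assms by (auto simp: farey_def)
  hence "(\<Sum>p\<in>farey N. N div fst p) > 0"
    using assms by (intro sum_pos2[of _ "(1, 0)"]) auto
  from partial_fractions_exist[OF finite_farey inj_on_farey_root this] obtain c where
    c: "\<And>x. x \<notin> farey_root ` farey N \<Longrightarrow> 1 / (\<Prod>p\<in>farey N. (x - farey_root p) ^ (N div fst p)) =
           (\<Sum>p\<in>farey N. \<Sum>l=1..N div fst p. c p l / (x - farey_root p) ^ l)" by blast
  define C where "C h k l = (if rademacher_index N h k l then (-1) ^ N * c (k, h) l else 0)" for h k l
  have "1 / (\<Prod>j=1..N. 1 - x ^ j) =
      (\<Sum>p\<in>farey N. \<Sum>l=1..N div fst p. C (snd p) (fst p) l / (x - farey_root p) ^ l)"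
    if x: "x \<notin> farey_root ` farey N" for x
  proof -
    have "1 / (\<Prod>j=1..N. 1 - x ^ j) =
        (-1) ^ N * (1 / (\<Prod>p\<in>farey N. (x - farey_root p) ^ (N div fst p)))"
      unfolding prod_one_minus_power_factorization by (cases "even N") auto
    also have "\<dots> = (\<Sum>p\<in>farey N. \<Sum>l=1..N div fst p. (-1) ^ N * c p l / (x - farey_root p) ^ l)"
      unfolding c[OF x] by (simp add: sum_distrib_left)
    also have "\<dots> = (\<Sum>p\<in>farey N. \<Sum>l=1..N div fst p. C (snd p) (fst p) l / (x - farey_root p) ^ l)"
      by (intro sum.cong refl) (auto simp: C_def rademacher_index_def farey_def)
    finally show ?thesis .
  qed
  hence "rademacher_expansion N C"
    unfolding rademacher_expansion_iff by (auto simp: C_def)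
  thus ?thesis by blast
qed

text \<open>
  The expanded function does not mention \<open>C\<close>, so its Taylor series determines the coefficients at the
  chosen pole.  This yields both the uniqueness of the expansion and a way to compute it.
\<close>

lemma rademacher_expansion_fps:
  assumes C: "rademacher_expansion N C" and p: "p \<in> farey N"
  obtains G where
    "(\<lambda>y. y ^ Suc (N div fst p) / (\<Prod>j=1..N. 1 - (farey_root p + y) ^ j)) has_fps_expansion G"
    "\<And>l. l \<in> {1..N div fst p} \<Longrightarrow> fps_nth G (Suc (N div fst p) - l) = C (snd p) (fst p) l"
proof -
  let ?S = "\<lambda>x. \<Sum>p\<in>farey N. \<Sum>l=1..N div fst p. C (snd p) (fst p) l / (x - farey_root p) ^ l"
  obtain G where G: "(\<lambda>y. y ^ Suc (N div fst p) * ?S (farey_root p + y)) has_fps_expansion G"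
    "\<And>l. l \<in> {1..N div fst p} \<Longrightarrow> fps_nth G (Suc (N div fst p) - l) = C (snd p) (fst p) l"
    using pole_has_fps_expansion[OF finite_farey inj_on_farey_root p,
      of "\<lambda>p. N div fst p" "\<lambda>p l. C (snd p) (fst p) l"] by blast
  have "\<forall>\<^sub>F y in nhds 0. y ^ Suc (N div fst p) * ?S (farey_root p + y) =
      y ^ Suc (N div fst p) / (\<Prod>j=1..N. 1 - (farey_root p + y) ^ j)"
    using eventually_not_other_pole[OF finite_farey, of farey_root p N]
  proof eventually_elim
    case (elim y)
    hence "y = 0 \<or> 1 / (\<Prod>j=1..N. 1 - (farey_root p + y) ^ j) = ?S (farey_root p + y)"
      using C unfolding rademacher_expansion_iff by blast
    thus ?case by (auto simp: divide_inverse)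
  qed
  from has_fps_expansion_cong[OF this refl, of G] G(1) have
    "(\<lambda>y. y ^ Suc (N div fst p) / (\<Prod>j=1..N. 1 - (farey_root p + y) ^ j)) has_fps_expansion G"
    by simp
  thus ?thesis using G(2) by (rule that)
qed

lemma rademacher_expansion_unique:
  assumes C: "rademacher_expansion N C" and D: "rademacher_expansion N D"
  shows "C = D"
proof (intro ext)
  fix h k l
  show "C h k l = D h k l"
  proof (cases "rademacher_index N h k l")
    case False
    thus ?thesis using assms by (simp add: rademacher_expansion_def)
  next
    case True
    hence p: "(k, h) \<in> farey N" and l: "l \<in> {1..N div k}"
      by (auto simp: rademacher_index_def farey_def)
    from rademacher_expansion_fps[OF C p] obtain G where G:
      "(\<lambda>y. y ^ Suc (N div k) / (\<Prod>j=1..N. 1 - (farey_root (k, h) + y) ^ j)) has_fps_expansion G"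
      "\<And>l. l \<in> {1..N div k} \<Longrightarrow> fps_nth G (Suc (N div k) - l) = C h k l"
      unfolding fst_conv snd_conv by blast
    from rademacher_expansion_fps[OF D p] obtain H where H:
      "(\<lambda>y. y ^ Suc (N div k) / (\<Prod>j=1..N. 1 - (farey_root (k, h) + y) ^ j)) has_fps_expansion H"
      "\<And>l. l \<in> {1..N div k} \<Longrightarrow> fps_nth H (Suc (N div k) - l) = D h k l"
      unfolding fst_conv snd_conv by blast
    have "G = H" using G(1) H(1) by (rule fps_expansion_unique_complex)
    thus ?thesis using G(2)[OF l] H(2)[OF l] by simp
  qed
qed

lemma rademacher_expansion_rademacher_coeff:
  assumes "N \<ge> 1"
  shows "rademacher_expansion N (\<lambda>h k l. rademacher_coeff h k l N)"
proof -
  have "\<exists>!C. rademacher_expansion N C"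
    using rademacher_expansion_exists[OF assms] rademacher_expansion_unique by blast
  from theI'[OF this] show ?thesis by (simp add: rademacher_coeff_def)
qed

section \<open>The pole at minus one\<close>

lemma one_minus_X_power_nth:
  "fps_nth ((1 - fps_X) ^ k :: complex fps) i = (-1) ^ i * of_nat (k choose i)"
proof (induction k arbitrary: i)
  case (Suc k)
  show ?case by (cases i) (simp_all add: Suc algebra_simps)
qed (auto simp: binomial_eq_0)

text \<open>
  The geometric sum for \<open>(1 - (1 - X) ^ k) / X\<close>: in this form the simple zero of \<open>1 - (1 - X) ^ k\<close>
  at \<open>X = 0\<close> is already cancelled.
\<close>

definition geom :: "nat \<Rightarrow> complex fps" where
  "geom k = (\<Sum>i<k. (1 - fps_X) ^ i)"

lemma X_mult_geom: "fps_X * geom k = 1 - (1 - fps_X) ^ k"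
  unfolding geom_def using one_diff_power_eq[of "1 - fps_X :: complex fps" k] by simp

lemma geom_nth: "fps_nth (geom k) i = (-1) ^ i * of_nat (k choose Suc i)"
proof -
  have "fps_nth (geom k) i = fps_nth (fps_X * geom k) (Suc i)" by simp
  also have "\<dots> = (-1) ^ i * of_nat (k choose Suc i)"
    by (simp only: X_mult_geom fps_sub_nth one_minus_X_power_nth) simp
  finally show ?thesis .
qed

text \<open>
  With \<open>x = X - 1\<close>, the factor \<open>1 - x ^ j\<close> is \<open>1 + (1 - X) ^ j\<close> for odd \<open>j\<close> and \<open>X * geom j\<close> for even \<open>j\<close>.
  The cofactor collects what is left of the factors with \<open>j \<le> 2 * n + 1\<close> after the \<open>n\<close> powers of \<open>X\<close>
  are removed.
\<close>

fun cofactor :: "nat \<Rightarrow> complex fps" where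
  "cofactor 0 = 2 - fps_X"
| "cofactor (Suc n) = cofactor n * (geom (2 * n + 2) * (1 + (1 - fps_X) ^ (2 * n + 3)))"

lemma prod_eq_X_power_mult_cofactor:
  "(\<Prod>j=1..2*n+1. 1 - (fps_X - 1) ^ j) = fps_X ^ n * cofactor n"
proof (induction n)
  case (Suc n)
  have eq: "(fps_X - 1) ^ j = (-1) ^ j * (1 - fps_X :: complex fps) ^ j" for j
    using power_mult_distrib[of "-1" "1 - fps_X :: complex fps" j] by simp
  have ivl: "{1..2 * Suc n + 1} = insert (2*n+3) (insert (2*n+2) {1..2*n+1})" by auto
  have "(\<Prod>j=1..2*Suc n+1. 1 - (fps_X - 1) ^ j) =
      (1 - (fps_X - 1) ^ (2*n+3)) * ((1 - (fps_X - 1) ^ (2*n+2)) *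
        (\<Prod>j=1..2*n+1. 1 - (fps_X - 1 :: complex fps) ^ j))"
    unfolding ivl by (subst prod.insert, simp, simp, subst prod.insert) simp_all
  also note Suc.IH
  also have "1 - (fps_X - 1 :: complex fps) ^ (2*n+3) = 1 + (1 - fps_X) ^ (2*n+3)"
    unfolding eq by simp
  also have "1 - (fps_X - 1 :: complex fps) ^ (2*n+2) = fps_X * geom (2*n+2)"
    unfolding eq X_mult_geom by simp
  finally show ?case by (simp add: mult_ac)
qed simp

lemma cofactor_nth_0: "fps_nth (cofactor n) 0 \<noteq> 0"
  by (induction n) (auto simp: geom_nth one_minus_X_power_nth fps_nth_power_0 simp flip: of_nat_Suc)

text \<open>
  Near \<open>x = -1\<close> the function is \<open>(x + 1) ^ (-n)\<close> times the reciprocal of the cofactor, so the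
  coefficient of \<open>(x + 1) ^ (-(n - i))\<close> is the \<open>i\<close>-th Taylor coefficient of that reciprocal.
\<close>

lemma rademacher_coeff_eq_inverse_cofactor:
  assumes "i < n"
  shows "rademacher_coeff 1 2 (n - i) (2 * n + 1) = fps_nth (inverse (cofactor n)) i"
proof -
  define N where "N = 2 * n + 1"
  have N: "N \<ge> 1" "N div 2 = n" by (auto simp: N_def)
  have p: "(2, 1) \<in> farey N" using assms by (simp add: farey_def N_def)
  have root: "farey_root (2, 1) = -1"
    by (simp add: farey_root_def exp_pi_i)
  obtain G where G: "(\<lambda>y. y ^ Suc n / (\<Prod>j=1..N. 1 - (-1 + y) ^ j)) has_fps_expansion G"
      "\<And>l. l \<in> {1..n} \<Longrightarrow> fps_nth G (Suc n - l) = rademacher_coeff 1 2 l N"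
    using rademacher_expansion_fps[OF rademacher_expansion_rademacher_coeff[OF N(1)] p]
    unfolding fst_conv snd_conv root N(2) by blast
  have "(\<lambda>y. (y ^ Suc n / (\<Prod>j=1..N. 1 - (-1 + y) ^ j)) * (\<Prod>j=1..N. 1 - (-1 + y) ^ j))
      has_fps_expansion G * (\<Prod>j=1..N. 1 - (-1 + fps_X) ^ j)"
    by (intro fps_expansion_intros G(1))
  also have "?this \<longleftrightarrow> (\<lambda>y. y ^ Suc n) has_fps_expansion G * (\<Prod>j=1..N. 1 - (-1 + fps_X) ^ j)"
  proof (rule has_fps_expansion_cong[OF _ refl])
    show "\<forall>\<^sub>F y::complex in nhds 0. (y ^ Suc n / (\<Prod>j=1..N. 1 - (-1 + y) ^ j)) *
        (\<Prod>j=1..N. 1 - (-1 + y) ^ j) = y ^ Suc n"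
      using eventually_not_other_pole[OF finite_farey[of N], of farey_root "(2, 1)"]
    proof eventually_elim
      case (elim y)
      have "(\<Prod>j=1..N. 1 - (-1 + y) ^ j) \<noteq> 0" if "y \<noteq> 0"
        using elim that unfolding prod_one_minus_power_factorization root by auto
      thus ?case by (cases "y = 0") simp_all
    qed
  qed
  finally have "G * (\<Prod>j=1..N. 1 - (-1 + fps_X) ^ j) = fps_X ^ Suc n"
    using has_fps_expansion_fps_X_power by (rule fps_expansion_unique_complex)
  hence "fps_X ^ n * (G * cofactor n) = fps_X ^ n * fps_X"
    unfolding N_def uminus_add_conv_diff prod_eq_X_power_mult_cofactor by (simp add: mult_ac)
  hence "G * cofactor n = fps_X" by simp
  hence "G * (cofactor n * inverse (cofactor n)) = fps_X * inverse (cofactor n)"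
    by (simp flip: mult.assoc)
  hence G_eq: "G = fps_X * inverse (cofactor n)"
    using inverse_mult_eq_1'[OF cofactor_nth_0, of n] by simp
  have "rademacher_coeff 1 2 (n - i) N = fps_nth G (Suc n - (n - i))"
    using assms by (intro G(2)[symmetric]) auto
  also have "Suc n - (n - i) = Suc i" using assms by simp
  also have "fps_nth G (Suc i) = fps_nth (inverse (cofactor n)) i" unfolding G_eq by simp
  finally show ?thesis by (simp add: N_def)
qed

section \<open>The first three Taylor coefficients\<close>

lemma of_nat_choose_2: "(of_nat (k choose 2) :: complex) = of_nat k * (of_nat k - 1) / 2"
  by (induction k) (simp_all add: numeral_2_eq_2 field_simps)

lemma of_nat_choose_3:
  "(of_nat (k choose 3) :: complex) = of_nat k * (of_nat k - 1) * (of_nat k - 2) / 6"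
proof (induction k)
  case (Suc k)
  have "Suc k choose 3 = (k choose 2) + (k choose 3)" by (simp add: numeral_3_eq_3 numeral_2_eq_2)
  thus ?case by (simp add: of_nat_choose_2 Suc field_simps)
qed auto

lemma fps_mult_nth_012:
  fixes F G :: "complex fps"
  shows "fps_nth (F * G) 0 = fps_nth F 0 * fps_nth G 0"
    and "fps_nth (F * G) 1 = fps_nth F 0 * fps_nth G 1 + fps_nth F 1 * fps_nth G 0"
    and "fps_nth (F * G) 2 = fps_nth F 0 * fps_nth G 2 + fps_nth F 1 * fps_nth G 1 + fps_nth F 2 * fps_nth G 0"
  by (simp_all add: fps_mult_nth numeral_2_eq_2)

lemma geom_nth_012:
  "fps_nth (geom k) 0 = of_nat k"
  "fps_nth (geom k) 1 = - (of_nat k * (of_nat k - 1) / 2)"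
  "fps_nth (geom k) 2 = of_nat k * (of_nat k - 1) * (of_nat k - 2) / 6"
  using of_nat_choose_2[of k] of_nat_choose_3[of k]
  by (simp_all add: geom_nth numeral_2_eq_2 numeral_3_eq_3)

lemma one_plus_nth_012:
  "fps_nth (1 + (1 - fps_X) ^ k :: complex fps) 0 = 2"
  "fps_nth (1 + (1 - fps_X) ^ k :: complex fps) 1 = - of_nat k"
  "fps_nth (1 + (1 - fps_X) ^ k :: complex fps) 2 = of_nat k * (of_nat k - 1) / 2"
  unfolding fps_add_nth one_minus_X_power_nth of_nat_choose_2 by simp_all

text \<open>
  Passing from \<open>n\<close> to \<open>n + 1\<close> multiplies the cofactor by a series \<open>D\<close> with known low coefficients,
  so the new reciprocal \<open>R'\<close> and the old one \<open>R\<close> satisfy \<open>R' * D = R\<close>.  Comparing the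
  coefficients of \<open>1\<close>, \<open>X\<close> and \<open>X ^ 2\<close> gives a triangular linear system for those of \<open>R'\<close>, and the
  closed forms solve it.
\<close>

lemma inverse_cofactor_nth:
  "fps_nth (inverse (cofactor n)) 0 = 1 / (2 ^ (2 * n + 1) * fact n) \<and>
   fps_nth (inverse (cofactor n)) 1 = (2 * of_nat n ^ 2 + 2 * of_nat n + 1) / (2 ^ (2 * n + 2) * fact n) \<and>
   fps_nth (inverse (cofactor n)) 2 = (18 * of_nat n ^ 5 + 46 * of_nat n ^ 4 + 61 * of_nat n ^ 3
      + 53 * of_nat n ^ 2 + 29 * of_nat n + 9) / (9 * 2 ^ (2 * n + 3) * fact (n + 1))"
proof (induction n)
  case 0
  let ?R = "inverse (cofactor 0)"
  have "?R * (2 - fps_X) = 1" using inverse_mult_eq_1[OF cofactor_nth_0, of 0] by simp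
  from arg_cong[OF this, of "\<lambda>F. fps_nth F 0"] arg_cong[OF this, of "\<lambda>F. fps_nth F 1"]
    arg_cong[OF this, of "\<lambda>F. fps_nth F 2"]
  have "fps_nth ?R 0 * 2 = 1" "fps_nth ?R 1 * 2 = fps_nth ?R 0" "fps_nth ?R 2 * 2 = fps_nth ?R 1"
    by (simp_all only: fps_mult_nth_012) (simp_all add: fps_numeral_nth)
  note eqs = this
  have two: "(2::complex) \<noteq> 0" by simp
  note nth = eq_divide_imp[OF two eqs(1)] eq_divide_imp[OF two eqs(2)] eq_divide_imp[OF two eqs(3)]
  show ?case unfolding nth(3) nth(2) nth(1) by simp
next
  case (Suc n)
  \<comment> \<open>In terms of \<open>w = n + 1\<close> and \<open>q\<close> all coefficients are rational functions with denominators
      \<open>w\<close>, \<open>w + 1\<close> and \<open>q\<close>.\<close>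
  define w :: complex where "w = of_nat (Suc n)"
  define D :: "complex fps" where "D = geom (2 * n + 2) * (1 + (1 - fps_X) ^ (2 * n + 3))"
  define R where "R = inverse (cofactor n)"
  define R' where "R' = inverse (cofactor (Suc n))"
  have k: "of_nat (2 * n + 2) = 2 * w" "of_nat (2 * n + 3) = 2 * w + 1"
    by (simp_all add: w_def)
  have D0: "fps_nth D 0 = 4 * w"
    unfolding D_def fps_mult_nth_012 geom_nth_012 one_plus_nth_012 k by simp
  have D1: "fps_nth D 1 = - 8 * w ^ 2"
    unfolding D_def fps_mult_nth_012 geom_nth_012 one_plus_nth_012 k by (simp, algebra)
  have D2: "fps_nth D 2 = (32 * w ^ 3 - 6 * w ^ 2 + w) / 3"
    unfolding D_def fps_mult_nth_012 geom_nth_012 one_plus_nth_012 k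
    by (simp add: field_simps, algebra)
  have "R' * D = R"
  proof -
    have "cofactor n * R = 1" "R' * (cofactor n * D) = 1"
      using inverse_mult_eq_1[OF cofactor_nth_0, of "Suc n"] inverse_mult_eq_1[OF cofactor_nth_0, of n]
      by (simp_all add: D_def R'_def R_def mult.commute)
    have "R' * D = (R' * D) * (cofactor n * R)" by (simp add: \<open>cofactor n * R = 1\<close>)
    also have "\<dots> = (R' * (cofactor n * D)) * R" by (simp only: mult_ac)
    finally show ?thesis by (simp add: \<open>R' * (cofactor n * D) = 1\<close>)
  qed
  from arg_cong[OF this, of "\<lambda>F. fps_nth F 0"] arg_cong[OF this, of "\<lambda>F. fps_nth F 1"]
    arg_cong[OF this, of "\<lambda>F. fps_nth F 2"]
  have eqs: "fps_nth R' 0 * fps_nth D 0 = fps_nth R 0"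
    "fps_nth R' 1 * fps_nth D 0 = fps_nth R 1 - fps_nth R' 0 * fps_nth D 1"
    "fps_nth R' 2 * fps_nth D 0 = fps_nth R 2 - fps_nth R' 0 * fps_nth D 2 - fps_nth R' 1 * fps_nth D 1"
    by (simp_all only: fps_mult_nth_012) (simp_all add: algebra_simps)
  define q :: complex where "q = 2 ^ (2 * n) * fact n"
  have w1: "w + 1 = of_nat (n + 2)" by (simp add: w_def)
  have w_nz: "w \<noteq> 0" unfolding w_def of_nat_eq_0_iff by simp
  have w1_nz: "w + 1 \<noteq> 0" unfolding w1 of_nat_eq_0_iff by simp
  have nz: "w \<noteq> 0" "w + 1 \<noteq> 0" "q \<noteq> 0" "4 * w \<noteq> 0"
    using w_nz w1_nz by (simp_all add: q_def)
  have n: "of_nat n = w - 1" and facts: "fact (Suc n) = w * fact n"  "fact (n + 1) = w * fact n"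
      "fact (Suc n + 1) = (w + 1) * (w * fact n)"
    by (simp_all add: w_def algebra_simps)
  have pow: "2 ^ (2 * n + 1) = (2 * 2 ^ (2 * n) :: complex)" "2 ^ (2 * n + 2) = (4 * 2 ^ (2 * n) :: complex)"
     "2 ^ (2 * n + 3) = (8 * 2 ^ (2 * n) :: complex)" "2 ^ (2 * Suc n + 1) = (8 * 2 ^ (2 * n) :: complex)"
     "2 ^ (2 * Suc n + 2) = (16 * 2 ^ (2 * n) :: complex)" "2 ^ (2 * Suc n + 3) = (32 * 2 ^ (2 * n) :: complex)"
    by (simp_all add: power_add)
  have IH: "fps_nth R 0 = 1 / (2 * q)" "fps_nth R 1 = (2 * (w - 1) ^ 2 + 2 * (w - 1) + 1) / (4 * q)"
    "fps_nth R 2 = (18 * (w - 1) ^ 5 + 46 * (w - 1) ^ 4 + 61 * (w - 1) ^ 3 + 53 * (w - 1) ^ 2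
        + 29 * (w - 1) + 9) / (72 * w * q)"
    using Suc.IH unfolding R_def n pow facts q_def by (simp_all add: mult_ac)
  have R0: "fps_nth R' 0 = 1 / (8 * w * q)"
    using eq_divide_imp[OF nz(4) eqs(1)[unfolded D0]] unfolding IH by simp
  have R1: "fps_nth R' 1 = (2 * w ^ 2 + 2 * w + 1) / (16 * w * q)"
  proof -
    have "fps_nth R' 1 = ((2 * (w - 1) ^ 2 + 2 * (w - 1) + 1) / (4 * q) + 8 * w ^ 2 / (8 * w * q)) / (4 * w)"
      using eq_divide_imp[OF nz(4) eqs(2)[unfolded D0]] unfolding IH R0 D1 by simp
    also have "\<dots> = (2 * w ^ 2 + 2 * w + 1) / (16 * w * q)"
      using nz by (simp add: divide_simps) algebra
    finally show ?thesis .
  qed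
  have R2: "fps_nth R' 2 = (18 * w ^ 5 + 46 * w ^ 4 + 61 * w ^ 3 + 53 * w ^ 2 + 29 * w + 9) /
      (288 * (w + 1) * w * q)"
  proof -
    have "fps_nth R' 2 = ((18 * (w - 1) ^ 5 + 46 * (w - 1) ^ 4 + 61 * (w - 1) ^ 3 + 53 * (w - 1) ^ 2
        + 29 * (w - 1) + 9) / (72 * w * q) - (32 * w ^ 3 - 6 * w ^ 2 + w) / (24 * w * q)
        + 8 * w ^ 2 * (2 * w ^ 2 + 2 * w + 1) / (16 * w * q)) / (4 * w)"
      using eq_divide_imp[OF nz(4) eqs(3)[unfolded D0]] unfolding IH R0 R1 D1 D2 by simp
    also have "\<dots> = (18 * w ^ 5 + 46 * w ^ 4 + 61 * w ^ 3 + 53 * w ^ 2 + 29 * w + 9) /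
      (288 * (w + 1) * w * q)"
      using nz by (simp add: divide_simps) algebra
    finally show ?thesis .
  qed
  show ?case
    unfolding R'_def[symmetric] R0 R1 R2 facts pow w_def[symmetric] q_def
    by (simp add: mult_ac)
qed

theorem mainTheorem4:
  shows "(\<forall>n::nat. n \<ge> 1 \<longrightarrow>
            rademacher_coeff 1 2 n (2 * n + 1) = 1 / (2 ^ (2 * n + 1) * fact n)) \<and>
         (\<forall>n::nat. n \<ge> 2 \<longrightarrow>
            rademacher_coeff 1 2 (n - 1) (2 * n + 1) =
              (2 * of_nat n ^ 2 + 2 * of_nat n + 1) / (2 ^ (2 * n + 2) * fact n)) \<and>
         (\<forall>n::nat. n \<ge> 3 \<longrightarrow>
            rademacher_coeff 1 2 (n - 2) (2 * n + 1) =
              (18 * of_nat n ^ 5 + 46 * of_nat n ^ 4 + 61 * of_nat n ^ 3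
                + 53 * of_nat n ^ 2 + 29 * of_nat n + 9)
              / (9 * 2 ^ (2 * n + 3) * fact (n + 1)))"
proof (intro conjI allI impI)
  fix n :: nat
  {
    assume "n \<ge> 1"
    thus "rademacher_coeff 1 2 n (2 * n + 1) = 1 / (2 ^ (2 * n + 1) * fact n)"
      using rademacher_coeff_eq_inverse_cofactor[of 0 n] inverse_cofactor_nth[of n] by simp
  next
    assume "n \<ge> 2"
    thus "rademacher_coeff 1 2 (n - 1) (2 * n + 1) =
        (2 * of_nat n ^ 2 + 2 * of_nat n + 1) / (2 ^ (2 * n + 2) * fact n)"
      using rademacher_coeff_eq_inverse_cofactor[of 1 n] inverse_cofactor_nth[of n] by simp
  next
    assume "n \<ge> 3"
    hence "rademacher_coeff 1 2 (n - 2) (2 * n + 1) = fps_nth (inverse (cofactor n)) 2"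
      by (intro rademacher_coeff_eq_inverse_cofactor) auto
    thus "rademacher_coeff 1 2 (n - 2) (2 * n + 1) =
        (18 * of_nat n ^ 5 + 46 * of_nat n ^ 4 + 61 * of_nat n ^ 3
          + 53 * of_nat n ^ 2 + 29 * of_nat n + 9) / (9 * 2 ^ (2 * n + 3) * fact (n + 1))"
      using inverse_cofactor_nth[of n] by (simp only:)
  }
qed

end
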